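(* The following are equivalent: (1) ODF: there is $C>0$ such that for all $n$ and all $v\in V_n$, $|v|\le C|Pv|$. (2) There exists $\delta<1$ such that for all $n$, $\delta_O(V_n,\overline V)\le\delta$.
   Context: Setting. $O$ is an infinite dimensional separable real Hilbert space with scalar product $\langle\cdot,\cdot\rangle$ and norm $|\cdot|$. $X\subseteq O$ is a dense subspace, itself a Hilbert space with continuous inclusion $X\to O$. $a$ is a continuous symmetric bilinear form on $X$ with $a(u,u)\ge 0$ for all $u\in X$, such that $\langle\cdot,\cdot\rangle+a$ is coercive on $X$; this form is taken as the scalar product of $X$, so $\|u\|^2=|u|^2+a(u,u)$ is the norm of $X$. Define $W=\{u\in X: a(u,u')=0\ \forall u'\in X\}$ and $V=\{u\in X:\langle u,w\rangle=0\ \forall w\in W\}$, so $X=V\oplus W$; $W$ is closed in $O$ and may be infinite dimensional. $\overline V$ is the closure of $V$ in $O$; it is the $O$-orthogonal complement of $W$. $P$ is the $O$-orthogonal projector in $O$ with range $\overline V$ and kernel $W$. It is assumed that the injection $V\to O$ is compact ($V$ carrying the norm of $X$). Discretization. $(X_n)_{n\in\mathbb N}$ is a sequence of finite dimensional subspaces of $X$ satisfying AS: for all $u\in X$, $\lim_{n\to\infty}\inf_{u'\in X_n}\|u-u'\|=0$. Define $W_n=\{u\in X_n: a(u,u')=0\ \forall u'\in X_n\}=X_n\cap W$ and $V_n=\{u\in X_n:\langle u,w\rangle=0\ \forall w\in W_n\}$, so $X_n=V_n\oplus W_n$ ($V_n$ need not be contained in $V$). Gap in $O$. For subspaces $U,U'$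 of $O$, $\delta_O(U,U')=\sup_{u\in U,u\ne0}\inf_{u'\in U'}|u-u'|/|u|$ (supremum over the empty set being $0$). *)

theory Defs
  imports "HOL-Analysis.Analysis"
begin

definition symmetric_bilinear_on :: "'a::real_vector set \<Rightarrow> ('a \<Rightarrow> 'a \<Rightarrow> real) \<Rightarrow> bool" where
  "symmetric_bilinear_on X b \<longleftrightarrow>
     (\<forall>u\<in>X. \<forall>v\<in>X. b u v = b v u) \<and>
     (\<forall>u\<in>X. \<forall>v\<in>X. \<forall>w\<in>X. b (u + v) w = b u w + b v w) \<and>
     (\<forall>c. \<forall>u\<in>X. \<forall>v\<in>X. b (c *\<^sub>R u) v = c * b u v)"

definition form_norm :: "('a \<Rightarrow> 'a \<Rightarrow> real) \<Rightarrow> 'a \<Rightarrow> real" where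
  "form_norm b u = sqrt (b u u)"

definition hilbert_space_on :: "'a::real_vector set \<Rightarrow> ('a \<Rightarrow> 'a \<Rightarrow> real) \<Rightarrow> bool" where
  "hilbert_space_on X h \<longleftrightarrow>
     subspace X \<and> symmetric_bilinear_on X h \<and> (\<forall>u\<in>X. u \<noteq> 0 \<longrightarrow> h u u > 0) \<and>
     (\<forall>s::nat \<Rightarrow> 'a. (\<forall>n. s n \<in> X) \<and>
        (\<forall>e>0. \<exists>N. \<forall>m\<ge>N. \<forall>n\<ge>N. form_norm h (s m - s n) < e) \<longrightarrow>
        (\<exists>l\<in>X. (\<lambda>n. form_norm h (s n - l)) \<longlonglongrightarrow> 0))"

definition energy :: "('o::real_inner \<Rightarrow> 'o \<Rightarrow> real) \<Rightarrow> 'o \<Rightarrow> 'o \<Rightarrow> real" where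
  "energy a u v = u \<bullet> v + a u v"

text \<open>The next two definitions are used both for U = X, giving W and V,
  and for U = Xs n, giving their discrete counterparts.\<close>

definition null_part :: "('o::real_inner \<Rightarrow> 'o \<Rightarrow> real) \<Rightarrow> 'o set \<Rightarrow> 'o set" where
  "null_part a U = {u \<in> U. \<forall>u'\<in>U. a u u' = 0}"

definition null_complement :: "('o::real_inner \<Rightarrow> 'o \<Rightarrow> real) \<Rightarrow> 'o set \<Rightarrow> 'o set" where
  "null_complement a U = {u \<in> U. \<forall>w\<in>null_part a U. u \<bullet> w = 0}"

text \<open>The orthogonal projector onto a closed subspace S of a Hilbert space; its kernel is the
  orthogonal complement of S.\<close>

definition orthogonal_projector :: "'o::real_inner set \<Rightarrow> 'o \<Rightarrow> 'o" where
  "orthogonal_projector S u = (THE p. p \<in> S \<and> (\<forall>s\<in>S. (u - p) \<bullet> s = 0))"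

text \<open>For subspaces the quotients lie between 0 and 1, so the real-valued infimum and supremum
  are the usual ones; the supremum over the empty set is 0 by convention.\<close>

definition gap :: "'o::real_normed_vector set \<Rightarrow> 'o set \<Rightarrow> real" where
  "gap U U' = (if U \<subseteq> {0} then 0
     else (SUP u\<in>U - {0}. INF u'\<in>U'. norm (u - u') / norm u))"

text \<open>O is the whole type. The parameter h is the scalar product with which X is
  given originally. From it only the topology of X matters: once coercivity is known, X is
  normed by the energy norm of the form \<open>energy a\<close>, which is equivalent to the norm of h.\<close>

locale form_setting =
  fixes X :: "'o::{real_inner,banach} set"
    and h a :: "'o \<Rightarrow> 'o \<Rightarrow> real"
  assumes infinite_dim: "\<not> (\<exists>B::'o set. finite B \<and> span B = UNIV)"
    and separable: "separable_space (euclidean :: 'o topology)"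
    and dense: "closure X = UNIV"
    and hilbert: "hilbert_space_on X h"
    and inclusion_continuous: "\<exists>C. \<forall>u\<in>X. norm u \<le> C * form_norm h u"
    and a_symmetric_bilinear: "symmetric_bilinear_on X a"
    and a_continuous: "\<exists>C. \<forall>u\<in>X. \<forall>v\<in>X. \<bar>a u v\<bar> \<le> C * form_norm h u * form_norm h v"
    and a_nonneg: "\<And>u. u \<in> X \<Longrightarrow> a u u \<ge> 0"
    and coercive: "\<exists>\<alpha>>0. \<forall>u\<in>X. energy a u u \<ge> \<alpha> * (form_norm h u)\<^sup>2"
    and compact_injection:
      "\<And>S. S \<subseteq> null_complement a X \<Longrightarrow> \<exists>K. \<forall>u\<in>S. form_norm (energy a) u \<le> K
         \<Longrightarrow> compact (closure S)"

locale galerkin_setting = form_setting X h a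
  for X :: "'o::{real_inner,banach} set" and h a :: "'o \<Rightarrow> 'o \<Rightarrow> real" +
  fixes Xs :: "nat \<Rightarrow> 'o set"
  assumes Xs_subspace: "\<And>n. subspace (Xs n)"
    and Xs_subset: "\<And>n. Xs n \<subseteq> X"
    and Xs_finite_dim: "\<And>n. \<exists>B. finite B \<and> span B = Xs n"
    and approximation:
      "\<And>u. u \<in> X \<Longrightarrow> (\<lambda>n. INF u'\<in>Xs n. form_norm (energy a) (u - u')) \<longlonglongrightarrow> 0"

end

theory Submission
  imports Defs
begin

text \<open>The infimum in the gap is attained at the orthogonal projection, so the gap bound says
  \<open>|v - Pv| \<le> \<delta> |v|\<close> for all \<open>v\<close>. By Pythagoras, \<open>|v|\<^sup>2 = |Pv|\<^sup>2 + |v - Pv|\<^sup>2\<close>, this is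
  equivalent to a bound \<open>|v| \<le> C |Pv|\<close>.\<close>

lemma subspace_null_complement:
  assumes "subspace U"
  shows "subspace (null_complement a U)"
  using assms
  by (auto simp: subspace_def null_complement_def inner_add_left)

lemma subspace_closure:
  fixes S :: "'a::real_normed_vector set"
  assumes "subspace S"
  shows "subspace (closure S)"
  unfolding subspace_def
proof (intro conjI ballI allI)
  show "0 \<in> closure S" using assms closure_subset subspace_0 by blast
next
  fix x y assume "x \<in> closure S" "y \<in> closure S"
  then obtain f g where "\<And>n. f n \<in> S" "f \<longlonglongrightarrow> x" "\<And>n. g n \<in> S" "g \<longlonglongrightarrow> y"
    unfolding closure_sequential by blast
  then show "x + y \<in> closure S"
    unfolding closure_sequential
    by (intro exI[of _ "\<lambda>n. f n + g n"]) (simp add: tendsto_add subspace_add[OF assms])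
next
  fix c x assume "x \<in> closure S"
  then obtain f where "\<And>n. f n \<in> S" "f \<longlonglongrightarrow> x"
    unfolding closure_sequential by blast
  then show "c *\<^sub>R x \<in> closure S"
    unfolding closure_sequential
    by (intro exI[of _ "\<lambda>n. c *\<^sub>R f n"]) (simp add: tendsto_scaleR subspace_scale[OF assms])
qed

text \<open>The classical argument: by the parallelogram law a minimising sequence is Cauchy.\<close>

lemma ex_nearest_point_closed_subspace:
  fixes S :: "'o::{real_inner,banach} set"
  assumes "subspace S" and "closed S"
  shows "\<exists>p\<in>S. \<forall>s\<in>S. norm (u - p) \<le> norm (u - s)"
proof -
  define d where "d = infdist u S"
  have ne: "S \<noteq> {}" using subspace_0[OF assms(1)] by auto
  have d_le: "d \<le> norm (u - s)" if "s \<in> S" for s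
    using infdist_le[OF that, of u] by (simp add: d_def dist_norm)
  have d0: "d \<ge> 0" by (simp add: d_def infdist_nonneg)
  \<comment> \<open>This supplies a minimising sequence: if all of \<open>S\<close> kept distance at
    least \<open>d + 1/(n+1)\<close> from \<open>u\<close>, so would the infimum that defines
    \<open>d\<close>.\<close>
  have "\<exists>s\<in>S. norm (u - s) < d + inverse (real (Suc n))" for n
  proof (rule ccontr)
    assume "\<not> ?thesis"
    then have "d + inverse (real (Suc n)) \<le> (INF s\<in>S. dist u s)"
      by (intro cINF_greatest ne) (auto simp: dist_norm not_less)
    then show False using ne by (simp add: d_def infdist_notempty)
  qed
  then obtain s where sS: "\<And>n. s n \<in> S"
    and s_lt: "\<And>n. norm (u - s n) < d + inverse (real (Suc n))"
    by metis
  have lim: "(\<lambda>n. norm (u - s n)) \<longlonglongrightarrow> d"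
  proof (rule tendsto_sandwich[where f = "\<lambda>_. d"])
    show "(\<lambda>n. d + inverse (real (Suc n))) \<longlonglongrightarrow> d"
      using tendsto_add[OF tendsto_const LIMSEQ_inverse_real_of_nat, of d] by simp
  qed (use d_le sS s_lt[THEN less_imp_le] in \<open>auto intro!: always_eventually\<close>)
  have "Cauchy s"
  proof (rule metric_CauchyI)
    fix e :: real assume e: "e > 0"
    have "(\<lambda>n. (norm (u - s n))\<^sup>2) \<longlonglongrightarrow> d\<^sup>2" by (intro tendsto_intros lim)
    \<comment> \<open>The margin \<open>e\<^sup>2 / 4\<close> fits the parallelogram law: two
      squared distances, each doubled, exceed \<open>4 * d\<^sup>2\<close> by less than
      \<open>e\<^sup>2\<close> in total.\<close>
    then have "\<forall>\<^sub>F n in sequentially. (norm (u - s n))\<^sup>2 < d\<^sup>2 + e\<^sup>2 / 4"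
      using e by (auto intro: order_tendstoD)
    then obtain N where N: "\<And>n. n \<ge> N \<Longrightarrow> (norm (u - s n))\<^sup>2 < d\<^sup>2 + e\<^sup>2 / 4"
      by (auto simp: eventually_sequentially)
    have "dist (s m) (s n) < e" if "m \<ge> N" "n \<ge> N" for m n
    proof -
      \<comment> \<open>The midpoint stays in \<open>S\<close>, hence at distance at least
        \<open>d\<close> from \<open>u\<close>, which controls the subtracted term of the
        parallelogram law.\<close>
      have "(1/2) *\<^sub>R (s m + s n) \<in> S"
        using sS assms(1) by (intro subspace_scale subspace_add)
      then have "d\<^sup>2 \<le> (norm (u - (1/2) *\<^sub>R (s m + s n)))\<^sup>2"
        using d_le d0 by (intro power_mono) auto
      moreover have "(norm (s m - s n))\<^sup>2 = 2 * (norm (u - s m))\<^sup>2 + 2 * (norm (u - s n))\<^sup>2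
          - 4 * (norm (u - (1/2) *\<^sub>R (s m + s n)))\<^sup>2"
        unfolding power2_norm_eq_inner by (simp add: algebra_simps inner_commute)
      ultimately have "(norm (s m - s n))\<^sup>2 < e\<^sup>2"
        using N[OF that(1)] N[OF that(2)] by simp
      then show ?thesis
        using e by (auto simp: dist_norm intro: power2_less_imp_less)
    qed
    then show "\<exists>M. \<forall>m\<ge>M. \<forall>n\<ge>M. dist (s m) (s n) < e" by blast
  qed
  then obtain p where p: "s \<longlonglongrightarrow> p" using Cauchy_convergent convergent_def by blast
  have "p \<in> S" using assms(2) p sS closed_sequentially by blast
  moreover have "norm (u - p) = d"
    using LIMSEQ_unique[OF tendsto_norm[OF tendsto_diff[OF tendsto_const p]] lim] .
  ultimately show ?thesis using d_le by auto
qed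

text \<open>These facts hold once the definite description is known to denote. A nearest point of
  \<open>S\<close> is a witness, and the difference of two witnesses is orthogonal to itself, hence
  zero.\<close>

lemma
  fixes S :: "'o::{real_inner,banach} set"
  assumes "subspace S" and "closed S"
  shows orthogonal_projector_in: "orthogonal_projector S u \<in> S"
    and orthogonal_projector_orthogonal: "s \<in> S \<Longrightarrow> (u - orthogonal_projector S u) \<bullet> s = 0"
proof -
  obtain p where p: "p \<in> S" "\<And>s. s \<in> S \<Longrightarrow> norm (u - p) \<le> norm (u - s)"
    using ex_nearest_point_closed_subspace[OF assms] by blast
  \<comment> \<open>Variational inequality for a nearest point of a convex set, tested at
    \<open>p + s\<close>. Using it for both \<open>s\<close> and \<open>- s\<close> turns it into
    orthogonality.\<close>
  have le: "(u - p) \<bullet> s \<le> 0" if "s \<in> S" for s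
    using any_closest_point_dot[OF subspace_imp_convex[OF assms(1)] assms(2) p(1), of "p + s" u]
      p that subspace_add[OF assms(1)] by (simp add: dist_norm)
  have orth: "\<forall>s\<in>S. (u - p) \<bullet> s = 0"
    using le le[OF subspace_neg[OF assms(1)]] by (force intro: antisym)
  have "\<exists>!p. p \<in> S \<and> (\<forall>s\<in>S. (u - p) \<bullet> s = 0)"
  proof (rule ex1I[of _ p])
    fix q assume q: "q \<in> S \<and> (\<forall>s\<in>S. (u - q) \<bullet> s = 0)"
    then have "p - q \<in> S" using p(1) subspace_diff[OF assms(1)] by blast
    with q orth have "(u - q) \<bullet> (p - q) - (u - p) \<bullet> (p - q) = 0" by simp
    then have "(p - q) \<bullet> (p - q) = 0" by (simp add: algebra_simps)
    then show "q = p" by simp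
  qed (use p orth in blast)
  from theI'[OF this] show "orthogonal_projector S u \<in> S"
    and "s \<in> S \<Longrightarrow> (u - orthogonal_projector S u) \<bullet> s = 0"
    unfolding orthogonal_projector_def by blast+
qed

text \<open>Pythagoras, as the residual is orthogonal to \<open>S\<close>. Varying \<open>s\<close>
  shows that the projection is nearest; \<open>s = 0\<close> splits the norm of
  \<open>u\<close>.\<close>

lemma norm_sub_sq_orthogonal_projector:
  fixes S :: "'o::{real_inner,banach} set"
  assumes "subspace S" and "closed S" and "s \<in> S"
  shows "(norm (u - s))\<^sup>2
    = (norm (u - orthogonal_projector S u))\<^sup>2 + (norm (orthogonal_projector S u - s))\<^sup>2"
proof -
  let ?p = "orthogonal_projector S u"
  have "(u - ?p) \<bullet> (?p - s) = 0"
    using orthogonal_projector_orthogonal[OF assms(1,2)]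
      orthogonal_projector_in[OF assms(1,2)] assms(3) subspace_diff[OF assms(1)] by blast
  then show ?thesis
    unfolding power2_norm_eq_inner by (simp add: algebra_simps inner_commute)
qed

text \<open>The projection minimises the numerator. For \<open>u = 0\<close> both sides are 0, since
  division by zero gives 0.\<close>

lemma INF_gap_eq:
  fixes S :: "'o::{real_inner,banach} set"
  assumes "subspace S" and "closed S"
  shows "(INF s\<in>S. norm (u - s) / norm u) = norm (u - orthogonal_projector S u) / norm u"
proof (rule cInf_eq_minimum)
  show "norm (u - orthogonal_projector S u) / norm u \<in> (\<lambda>s. norm (u - s) / norm u) ` S"
    using orthogonal_projector_in[OF assms] by blast
next
  fix x assume "x \<in> (\<lambda>s. norm (u - s) / norm u) ` S"
  then obtain s where s: "s \<in> S" "x = norm (u - s) / norm u" by blast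
  have "norm (u - orthogonal_projector S u) \<le> norm (u - s)"
    by (rule power2_le_imp_le) (simp_all add: norm_sub_sq_orthogonal_projector[OF assms s(1), of u])
  then show "norm (u - orthogonal_projector S u) / norm u \<le> x"
    unfolding s(2) by (rule divide_right_mono) simp
qed

text \<open>Replaces the supremum of infima by a pointwise estimate. Nonnegativity of \<delta>
  covers \<open>U \<subseteq> {0}\<close>, where the gap is 0 by convention.\<close>

lemma gap_le_iff:
  fixes S :: "'o::{real_inner,banach} set"
  assumes "subspace S" and "closed S" and "\<delta> \<ge> 0"
  shows "gap U S \<le> \<delta> \<longleftrightarrow> (\<forall>u\<in>U. norm (u - orthogonal_projector S u) \<le> \<delta> * norm u)"
proof -
  let ?P = "orthogonal_projector S"
  have contr: "norm (u - ?P u) \<le> norm u" for u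
    by (rule power2_le_imp_le)
      (use norm_sub_sq_orthogonal_projector[OF assms(1,2) subspace_0[OF assms(1)], of u] in simp_all)
  have zero: "norm (0 - ?P 0) \<le> \<delta> * norm (0::'o)" using contr[of 0] by simp
  show ?thesis
  proof (cases "U \<subseteq> {0}")
    case True
    then show ?thesis using assms(3) zero by (auto simp: gap_def)
  next
    case False
    \<comment> \<open>A real supremum is governed by its elements only if they are bounded above;
      here every quotient is at most 1.\<close>
    have bdd: "bdd_above ((\<lambda>u. norm (u - ?P u) / norm u) ` (U - {0}))"
      using contr by (intro bdd_aboveI2[where M = 1]) (simp add: divide_le_eq)
    have "gap U S \<le> \<delta> \<longleftrightarrow> (\<forall>u\<in>U - {0}. norm (u - ?P u) / norm u \<le> \<delta>)"
      using False by (simp add: gap_def INF_gap_eq[OF assms(1,2)] cSUP_le_iff[OF _ bdd])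
    also have "\<dots> \<longleftrightarrow> (\<forall>u\<in>U. norm (u - ?P u) \<le> \<delta> * norm u)"
      using zero by (auto simp: divide_le_eq)
    finally show ?thesis .
  qed
qed

theorem proposition9:
  fixes X :: "'o::{real_inner,banach} set"
    and h a :: "'o \<Rightarrow> 'o \<Rightarrow> real"
    and Xs :: "nat \<Rightarrow> 'o set"
  assumes "galerkin_setting X h a Xs"
  shows "(\<exists>C>0. \<forall>n. \<forall>v\<in>null_complement a (Xs n).
            norm v \<le> C * norm (orthogonal_projector (closure (null_complement a X)) v))
     \<longleftrightarrow> (\<exists>\<delta><1. \<forall>n. gap (null_complement a (Xs n)) (closure (null_complement a X)) \<le> \<delta>)"
proof -
  interpret galerkin_setting X h a Xs by fact
  define S where "S = closure (null_complement a X)"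
  have S: "subspace S" "closed S"
    using hilbert by (simp_all add: S_def hilbert_space_on_def subspace_closure
        subspace_null_complement)
  let ?P = "orthogonal_projector S"
  have pyth: "(norm v)\<^sup>2 = (norm (v - ?P v))\<^sup>2 + (norm (?P v))\<^sup>2" for v
    using norm_sub_sq_orthogonal_projector[OF S subspace_0[OF S(1)], of v] by simp
  have "(\<exists>C>0. \<forall>n. \<forall>v\<in>null_complement a (Xs n). norm v \<le> C * norm (?P v))
    \<longleftrightarrow> (\<exists>\<delta><1. \<forall>n. gap (null_complement a (Xs n)) S \<le> \<delta>)"
  proof
    assume "\<exists>C>0. \<forall>n. \<forall>v\<in>null_complement a (Xs n). norm v \<le> C * norm (?P v)"
    then obtain C where C: "C > 0"
      "\<And>n v. v \<in> null_complement a (Xs n) \<Longrightarrow> norm v \<le> C * norm (?P v)" by blast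
    \<comment> \<open>From \<open>|Pv|\<^sup>2 \<ge> |v|\<^sup>2 / C\<^sup>2\<close> one gets \<open>|v - Pv|\<^sup>2 \<le> (1 - 1 / C\<^sup>2) |v|\<^sup>2\<close>; \<open>C\<^sup>2 + 1\<close>
      instead of \<open>C\<^sup>2\<close> keeps the radicand nonnegative when \<open>C < 1\<close>.\<close>
    define \<delta> where "\<delta> = sqrt (1 - 1 / (C\<^sup>2 + 1))"
    have pos: "C\<^sup>2 + 1 > 0" by (intro add_nonneg_pos) simp_all
    have rad: "1 / (C\<^sup>2 + 1) \<le> 1" using pos by (simp add: divide_le_eq)
    have "1 / (C\<^sup>2 + 1) > 0" using pos by (rule divide_pos_pos[OF zero_less_one])
    then have "\<delta> < 1" "\<delta> \<ge> 0" using rad by (simp_all add: \<delta>_def)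
    have sq: "\<delta>\<^sup>2 = 1 - 1 / (C\<^sup>2 + 1)" using rad by (simp add: \<delta>_def)
    have "norm (v - ?P v) \<le> \<delta> * norm v" if "v \<in> null_complement a (Xs n)" for n v
    proof (rule power2_le_imp_le)
      have "(norm v)\<^sup>2 \<le> C\<^sup>2 * (norm (?P v))\<^sup>2"
        using power_mono[OF C(2)[OF that], of 2] by (simp add: power_mult_distrib)
      also have "\<dots> \<le> (C\<^sup>2 + 1) * (norm (?P v))\<^sup>2" by (simp add: mult_right_mono)
      finally have "(norm v)\<^sup>2 / (C\<^sup>2 + 1) \<le> (norm (?P v))\<^sup>2"
        using pos by (simp add: pos_divide_le_eq mult.commute)
      then show "(norm (v - ?P v))\<^sup>2 \<le> (\<delta> * norm v)\<^sup>2"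
        using pyth[of v] by (simp add: power_mult_distrib sq left_diff_distrib)
    qed (use \<open>\<delta> \<ge> 0\<close> in simp)
    then show "\<exists>\<delta><1. \<forall>n. gap (null_complement a (Xs n)) S \<le> \<delta>"
      using \<open>\<delta> < 1\<close> gap_le_iff[OF S \<open>\<delta> \<ge> 0\<close>] by blast
  next
    assume "\<exists>\<delta><1. \<forall>n. gap (null_complement a (Xs n)) S \<le> \<delta>"
    then obtain \<delta>' where "\<delta>' < 1" "\<And>n. gap (null_complement a (Xs n)) S \<le> \<delta>'" by blast
    \<comment> \<open>Passing to \<open>max \<delta>' 0\<close> keeps the bound below 1 and makes it
      nonnegative, as \<open>gap_le_iff\<close> requires.\<close>
    then obtain \<delta> where \<delta>: "\<delta> < 1" "\<delta> \<ge> 0" "\<And>n. gap (null_complement a (Xs n)) S \<le> \<delta>"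
      using that[of "max \<delta>' 0"] by (simp add: le_max_iff_disj)
    \<comment> \<open>The triangle inequality suffices here: |v| - |Pv| \<le> |v - Pv| \<le>
      \<delta> |v|. Pythagoras would give the sharper constant
      \<open>1 / sqrt (1 - \<delta>\<^sup>2)\<close>.\<close>
    have "norm v \<le> 1 / (1 - \<delta>) * norm (?P v)" if "v \<in> null_complement a (Xs n)" for n v
    proof -
      have "norm (v - ?P v) \<le> \<delta> * norm v"
        using \<delta>(3) that gap_le_iff[OF S \<delta>(2)] by blast
      then have "(1 - \<delta>) * norm v \<le> norm (?P v)"
        using norm_triangle_ineq2[of v "?P v"] by (simp add: left_diff_distrib)
      then show ?thesis using \<delta>(1) by (simp add: field_simps)
    qed
    moreover have "1 / (1 - \<delta>) > 0" using \<delta>(1) by simp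
    ultimately show "\<exists>C>0. \<forall>n. \<forall>v\<in>null_complement a (Xs n). norm v \<le> C * norm (?P v)"
      by blast
  qed
  then show ?thesis unfolding S_def .
qed

end
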